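(* Let $p\geq 5$ be a prime, let $\alpha\geq 1$ be an integer, and let $k=p^{2\alpha-1}$. Then, as formal power series in $q$ with integer coefficients, \begin{align*} \sum_{n=0}^{\infty}\mathfrak{B}_k\!\left(2p^{2\alpha-1}n+\frac{p^{2\alpha}-1}{12}\right)q^n &\equiv \left((-1)^{\frac{\pm p-1}{6}}\right)^{\alpha}\sum_{n=0}^{\infty}b_p(n)q^n \pmod p,\\ \sum_{n=0}^{\infty}\mathfrak{B}_k\!\left(2p^{2\alpha-1}n+\frac{p^{2\alpha}-1}{12}\right)q^n &\equiv \left((-1)^{\frac{\pm p-1}{6}}\right)^{\alpha}(q^{p};q^{p})_{\infty}\sum_{n=0}^{\infty}p(n)q^n \pmod p, \end{align*} where the sign $\pm$ is chosen so that $(\pm p-1)/6$ is an integer (that is, $+$ if $p\equiv 1 \pmod 6$ and $-$ if $p\equiv -1\pmod 6$), and where $p(n)$ denotes the partition function.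
   Context: For $|q|<1$ write $(a;q)_\infty=\prod_{j=0}^{\infty}(1-aq^j)$. For an integer $k\geq 3$, $\mathfrak{B}_k(n)$ denotes the number of $k$ dots bracelet partitions of $n$; these integers are determined by the generating function \[ \sum_{n=0}^{\infty}\mathfrak{B}_{k}(n)q^n=\frac{(-q;q)_{\infty}}{(q;q)_{\infty}^{k-1}(-q^k;q^k)_{\infty}} . \] The partition function $p(n)$ (the number of partitions of $n$, not to be confused with the prime $p$) has generating function $\sum_{n=0}^{\infty}p(n)q^n=\frac{1}{(q;q)_\infty}$. For a positive integer $\ell$, $b_\ell(n)$ denotes the number of $\ell$-regular partitions of $n$ (partitions with no part divisible by $\ell$), with generating function \[ \sum_{n=0}^{\infty}b_\ell(n)q^n=\frac{(q^\ell;q^\ell)_{\infty}}{(q;q)_{\infty}} . \] A congruence modulo $m$ between power series with integer coefficients means that corresponding coefficients are congruent modulo $m$. *)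

theory Defs
  imports
    "HOL-Analysis.Analysis"
    "HOL-Computational_Algebra.Formal_Power_Series"
    "HOL-Number_Theory.Cong"
    "HOL-Library.Multiset"
begin

(* The infinite product is the library's prodinf, for the X-adic topology on formal power series.
   It converges when a and q have constant coefficient 0: see qpoch_inf_has_prod below. *)
definition qpoch_inf :: "int fps \<Rightarrow> int fps \<Rightarrow> int fps" where
  "qpoch_inf a q = (\<Prod>j. 1 - a * q ^ j)"

(* The divisor has constant coefficient 1, hence is a unit over the integers. Neither "inverse" nor
   "/" is available for power series over int, hence fps_right_inverse, whose second argument is
   the inverse of the constant coefficient. See bracelet_gf_mult for the defining identity. *)
definition bracelet_gf :: "nat \<Rightarrow> int fps" where
  "bracelet_gf k =
     qpoch_inf (- fps_X) fps_X *
     fps_right_inverse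
       (qpoch_inf fps_X fps_X ^ (k - 1) * qpoch_inf (- (fps_X ^ k)) (fps_X ^ k)) 1"

definition bracelet :: "nat \<Rightarrow> nat \<Rightarrow> int" where
  "bracelet k n = fps_nth (bracelet_gf k) n"

(* Partitions are multisets of positive integers. *)
definition partitions_of :: "nat \<Rightarrow> nat multiset set" where
  "partitions_of n = {M. 0 \<notin># M \<and> sum_mset M = n}"

definition num_partitions :: "nat \<Rightarrow> nat" where
  "num_partitions n = card (partitions_of n)"

definition num_regular_partitions :: "nat \<Rightarrow> nat \<Rightarrow> nat" where
  "num_regular_partitions l n = card {M \<in> partitions_of n. \<forall>x\<in>#M. \<not> l dvd x}"

definition fps_cong :: "int fps \<Rightarrow> int fps \<Rightarrow> int \<Rightarrow> bool" where
  "fps_cong F G m \<longleftrightarrow> (\<forall>n. [fps_nth F n = fps_nth G n] (mod m))"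

definition pm_sign :: "nat \<Rightarrow> int" where
  "pm_sign p = (if [p = 1] (mod 6) then 1 else - 1)"

(* The exponent (-p-1)/6 is negative. As (-1)^(-m) = (-1)^m, its absolute value is used;
   the division by 6 is exact for every prime p >= 5. *)
definition quad_sign :: "nat \<Rightarrow> int" where
  "quad_sign p = (- 1) ^ nat \<bar>(pm_sign p * int p - 1) div 6\<bar>"

lemma fps_nth_prod_stable:
  fixes a q :: "int fps"
  assumes "fps_nth a 0 = 0" "fps_nth q 0 = 0" "n \<le> m"
  shows "fps_nth (\<Prod>j\<le>m. 1 - a * q ^ j) n = fps_nth (\<Prod>j\<le>n. 1 - a * q ^ j) n"
  using assms(3)
proof (induction m rule: dec_induct)
  case (step m)
  let ?P = "\<Prod>j\<le>m. 1 - a * q ^ j"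
  have "fps_nth (q ^ Suc m) i = 0" if "i \<le> n" for i
    using that step.hyps assms(2) by (intro startsby_zero_power_prefix[rule_format]) auto
  then have "fps_nth (?P * a * q ^ Suc m) n = 0"
    unfolding fps_mult_nth[of "?P * a"] by (intro sum.neutral) simp
  moreover have "(\<Prod>j\<le>Suc m. 1 - a * q ^ j) = ?P - ?P * a * q ^ Suc m"
    by (simp only: prod.atMost_Suc right_diff_distrib mult_1_right mult.assoc)
  ultimately show ?case
    using step.IH by (simp only: fps_sub_nth diff_zero)
qed simp

lemma qpoch_inf_has_prod:
  fixes a q :: "int fps"
  assumes "fps_nth a 0 = 0" "fps_nth q 0 = 0"
  shows "(\<lambda>j. 1 - a * q ^ j) has_prod qpoch_inf a q"
proof -
  define P where "P = Abs_fps (\<lambda>n. fps_nth (\<Prod>j\<le>n. 1 - a * q ^ j) n)"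
  have "(\<lambda>m. \<Prod>j\<le>m. 1 - a * q ^ j) \<longlonglongrightarrow> P"
  proof (rule tendsto_fpsI)
    fix n
    show "\<forall>\<^sub>F m in sequentially. fps_nth (\<Prod>j\<le>m. 1 - a * q ^ j) n = fps_nth P n"
      using eventually_ge_at_top[of n]
      by eventually_elim (unfold P_def fps_nth_Abs_fps, rule fps_nth_prod_stable[OF assms])
  qed
  moreover have "fps_nth P 0 = 1"
    using assms by (simp add: P_def)
  then have "P \<noteq> 0" by auto
  ultimately have "(\<lambda>j. 1 - a * q ^ j) has_prod P"
    by (simp add: has_prod_def raw_has_prod_def)
  then show ?thesis
    unfolding qpoch_inf_def by (simp flip: has_prod_unique)
qed

lemma qpoch_inf_nth:
  assumes "fps_nth a 0 = 0" "fps_nth q 0 = 0"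
  shows "fps_nth (qpoch_inf a q) n = fps_nth (\<Prod>j\<le>n. 1 - a * q ^ j) n"
proof -
  have "0 \<notin> range (\<lambda>j. 1 - a * q ^ j)"
  proof
    assume "0 \<in> range (\<lambda>j. 1 - a * q ^ j)"
    then obtain j where "1 - a * q ^ j = 0" by force
    then have "fps_nth (1 - a * q ^ j) 0 = 0" by simp
    then show False using assms by simp
  qed
  then have "(\<lambda>m. \<Prod>j\<le>m. 1 - a * q ^ j) \<longlonglongrightarrow> qpoch_inf a q"
    using qpoch_inf_has_prod[OF assms]
    by (auto simp: has_prod_def raw_has_prod_def image_iff)
  then have "\<forall>\<^sub>F m in sequentially.
      fps_nth (\<Prod>j\<le>m. 1 - a * q ^ j) n = fps_nth (qpoch_inf a q) n"
    unfolding tendsto_fps_iff by blast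
  then obtain m where "m \<ge> n"
      "fps_nth (\<Prod>j\<le>m. 1 - a * q ^ j) n = fps_nth (qpoch_inf a q) n"
    unfolding eventually_sequentially by (meson nle_le)
  then show ?thesis
    using fps_nth_prod_stable[OF assms] by metis
qed

lemma bracelet_gf_mult:
  assumes "k > 0"
  shows "bracelet_gf k *
      (qpoch_inf fps_X fps_X ^ (k - 1) * qpoch_inf (- (fps_X ^ k)) (fps_X ^ k)) =
    qpoch_inf (- fps_X) fps_X"
proof -
  let ?D = "qpoch_inf fps_X fps_X ^ (k - 1) * qpoch_inf (- (fps_X ^ k)) (fps_X ^ k)"
  have "fps_nth ?D 0 = 1"
    using assms by (simp add: qpoch_inf_nth fps_power_zeroth)
  then have "fps_nth ?D 0 * 1 = 1"
    by (simp only: mult_1_right)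
  then have "?D * fps_right_inverse ?D 1 = 1"
    by (rule fps_right_inverse)
  then have "fps_right_inverse ?D 1 * ?D = 1"
    by (simp only: mult.commute)
  then show ?thesis
    unfolding bracelet_gf_def by (simp only: mult.assoc mult_1_right)
qed

end

theory Submission
  imports Defs
begin

text \<open>
  Write \<open>f\<^sub>m\<close> for the product of all \<open>1 - q^(m * i)\<close> with \<open>i \<ge> 1\<close> (\<open>euler_prod m\<close> below).
  Since \<open>(-q;q) = f\<^sub>2 / f\<^sub>1\<close>, the bracelet generating function is
  \<open>f\<^sub>2 f\<^sub>k / (f\<^sub>1^k f\<^bsub>2k\<^esub>)\<close>. As \<open>k\<close> is a power of \<open>p\<close>, the Frobenius congruence
  \<open>f\<^sub>1^k \<equiv> f\<^sub>k\<close> reduces it modulo \<open>p\<close> to \<open>f\<^sub>2 / f\<^bsub>2k\<^esub>\<close> (\<open>bracelet_gf_cong\<close>).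

  Put \<open>c = (p^(2 * \<alpha>) - 1) / 24\<close>. The theorem asks for the coefficients of this quotient at the
  indices \<open>2 * k * n + 2 * c\<close>. The denominator is a series in \<open>q^(2 * k)\<close>, so it comes out of
  the extraction as \<open>1 / f\<^sub>1\<close> (\<open>fps_section_mult_dilate\<close>), and what remains is to extract the
  coefficients of \<open>f\<^sub>1\<close> at the indices \<open>k * n + c\<close>.

  By Euler's pentagonal number theorem, \<open>f\<^sub>1\<close> has the coefficient \<open>(-1)^j\<close> at \<open>N\<close> if
  \<open>24 * N + 1 = (6 * j - 1)^2\<close>, and \<open>0\<close> if there is no such integer \<open>j\<close>. At \<open>N = k * n + c\<close> the
  equation reads \<open>(6 * j - 1)^2 = 24 * k * n + p^(2 * \<alpha>)\<close>. Its right-hand side is divisible by the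
  odd power \<open>k = p^(2 * \<alpha> - 1)\<close>, which forces \<open>p^\<alpha>\<close> to divide \<open>6 * j - 1\<close>; dividing it out
  leaves exactly the equation for the coefficient of \<open>f\<^sub>p\<close> at \<open>n\<close>. Only the parity of the index \<open>j\<close>
  changes, in a uniform way, and this produces the sign (\<open>euler_prod_section\<close>). The result is
  \<open>\<plusminus>f\<^sub>p / f\<^sub>1\<close>, which is both the generating function of the \<open>p\<close>-regular partitions and
  \<open>f\<^sub>p\<close> times that of all partitions.
\<close>

section \<open>Truncated congruences of power series\<close>

text \<open>
  Congruence modulo the ideal generated by \<open>m\<close> and \<open>X^(N + 1)\<close>. With \<open>m = 0\<close> it is equality of
  truncations, so that one relation serves both to replace an infinite product by a finite one
  and to compute modulo a prime.
\<close>

definition cong_upto :: "nat \<Rightarrow> int \<Rightarrow> int fps \<Rightarrow> int fps \<Rightarrow> bool" where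
  "cong_upto N m F G \<longleftrightarrow> (\<forall>n\<le>N. [fps_nth F n = fps_nth G n] (mod m))"

lemma cong_upto_refl [simp]: "cong_upto N m F F"
  by (simp add: cong_upto_def)

lemma cong_upto_sym: "cong_upto N m F G \<Longrightarrow> cong_upto N m G F"
  by (simp add: cong_upto_def cong_sym)

lemma cong_upto_trans [trans]:
  "cong_upto N m F G \<Longrightarrow> cong_upto N m G H \<Longrightarrow> cong_upto N m F H"
  unfolding cong_upto_def by (blast intro: cong_trans)

lemma cong_upto_mult:
  "cong_upto N m F F' \<Longrightarrow> cong_upto N m G G' \<Longrightarrow> cong_upto N m (F * G) (F' * G')"
  unfolding cong_upto_def fps_mult_nth by (auto intro!: cong_sum cong_mult)

lemma cong_upto_power: "cong_upto N m F G \<Longrightarrow> cong_upto N m (F ^ i) (G ^ i)"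
  by (induction i) (auto intro: cong_upto_mult)

lemma cong_upto_prod:
  "(\<And>x. x \<in> S \<Longrightarrow> cong_upto N m (f x) (g x)) \<Longrightarrow> cong_upto N m (prod f S) (prod g S)"
  by (induction S rule: infinite_finite_induct) (auto intro: cong_upto_mult)

lemma cong_upto_if_exact: "cong_upto N 0 F G \<Longrightarrow> cong_upto N m F G"
  by (simp add: cong_upto_def)

text \<open>A series with constant coefficient \<open>1\<close> is a unit over the integers.\<close>

lemma cong_upto_cancel:
  assumes "cong_upto N m (F * H) (G * H)" "fps_nth H 0 = 1"
  shows "cong_upto N m F G"
proof -
  have inv: "H * fps_right_inverse H 1 = 1"
    using assms(2) by (intro fps_right_inverse) simp
  have "cong_upto N m (F * H * fps_right_inverse H 1) (G * H * fps_right_inverse H 1)"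
    by (intro cong_upto_mult assms cong_upto_refl)
  then show ?thesis
    by (simp only: mult.assoc inv mult_1_right)
qed

lemma fps_eqI_cong_upto: "(\<And>N. cong_upto N 0 F G) \<Longrightarrow> F = G"
  by (auto simp: cong_upto_def fps_eq_iff)

section \<open>Euler products and their powers\<close>

definition euler_prod :: "nat \<Rightarrow> int fps" where
  "euler_prod m = qpoch_inf (fps_X ^ m) (fps_X ^ m)"

lemma qpoch_inf_cong_upto:
  assumes "fps_nth a 0 = 0" "fps_nth q 0 = 0" "N < M"
  shows "cong_upto N 0 (qpoch_inf a q) (\<Prod>i=1..M. 1 - a * q ^ (i - 1))"
proof -
  have "(\<Prod>i=1..M. 1 - a * q ^ (i - 1)) = (\<Prod>j\<le>M - 1. 1 - a * q ^ j)"
    using assms(3) by (intro prod.reindex_bij_witness[of _ Suc "\<lambda>i. i - 1"]) auto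
  moreover have "fps_nth (qpoch_inf a q) n = fps_nth (\<Prod>j\<le>M - 1. 1 - a * q ^ j) n" if "n \<le> N" for n
    using that assms qpoch_inf_nth[OF assms(1,2), of n]
      fps_nth_prod_stable[OF assms(1,2), of n "M - 1"] by simp
  ultimately show ?thesis
    by (simp add: cong_upto_def)
qed

lemma euler_prod_cong_upto:
  assumes "m > 0" "N < M"
  shows "cong_upto N 0 (euler_prod m) (\<Prod>i=1..M. 1 - fps_X ^ (m * i))"
proof -
  have "(\<Prod>i=1..M. 1 - fps_X ^ m * (fps_X ^ m) ^ (i - 1)) =
        (\<Prod>i=1..M. 1 - (fps_X :: int fps) ^ (m * i))"
  proof (rule prod.cong)
    fix i assume "i \<in> {1..M}"
    then have "fps_X ^ m * (fps_X ^ m) ^ (i - 1) = ((fps_X :: int fps) ^ m) ^ i"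
      by (cases i) auto
    then show "1 - fps_X ^ m * (fps_X ^ m) ^ (i - 1) = 1 - (fps_X :: int fps) ^ (m * i)"
      by (simp add: power_mult)
  qed simp
  then show ?thesis
    using qpoch_inf_cong_upto[of "fps_X ^ m" "fps_X ^ m" N M] assms
    by (simp add: euler_prod_def)
qed

lemma euler_prod_nth_0: "m > 0 \<Longrightarrow> fps_nth (euler_prod m) 0 = 1"
  by (simp add: euler_prod_def qpoch_inf_nth)

text \<open>Factorwise this is \<open>(1 + y) * (1 - y) = 1 - y^2\<close>.\<close>

lemma qpoch_inf_plus_times_minus:
  assumes "m > 0"
  shows "qpoch_inf (- (fps_X ^ m)) (fps_X ^ m) * euler_prod m = euler_prod (2 * m)"
proof (rule fps_eqI_cong_upto)
  fix N
  let ?x = "(fps_X :: int fps) ^ m"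
  have "cong_upto N 0 (qpoch_inf (- ?x) ?x * euler_prod m)
     ((\<Prod>i=1..Suc N. 1 - (- ?x) * ?x ^ (i - 1)) * (\<Prod>i=1..Suc N. 1 - ?x * ?x ^ (i - 1)))"
    unfolding euler_prod_def
    using assms by (intro cong_upto_mult qpoch_inf_cong_upto) auto
  also have "(\<Prod>i=1..Suc N. 1 - (- ?x) * ?x ^ (i - 1)) * (\<Prod>i=1..Suc N. 1 - ?x * ?x ^ (i - 1)) =
      (\<Prod>i=1..Suc N. 1 - fps_X ^ (2 * m * i))"
    unfolding prod.distrib[symmetric]
  proof (rule prod.cong)
    fix i assume "i \<in> {1..Suc N}"
    then have i: "?x * ?x ^ (i - 1) = ?x ^ i"
      by (cases i) auto
    show "(1 - - ?x * ?x ^ (i - 1)) * (1 - ?x * ?x ^ (i - 1)) = 1 - fps_X ^ (2 * m * i)"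
    proof -
      have "fps_X ^ (2 * m * i) = ?x ^ i * ?x ^ i"
        by (simp add: mult.assoc flip: power_mult power_add)
      moreover have "(1 - - y) * (1 - y) = 1 - y * y" for y :: "int fps"
        by (simp add: algebra_simps)
      ultimately show ?thesis
        unfolding minus_mult_left[symmetric] i by (simp only:)
    qed
  qed simp
  also have "cong_upto N 0 \<dots> (euler_prod (2 * m))"
    using assms by (intro cong_upto_sym[OF euler_prod_cong_upto]) auto
  finally show "cong_upto N 0 (qpoch_inf (- ?x) ?x * euler_prod m) (euler_prod (2 * m))" .
qed

text \<open>
  The inner binomial coefficients \<open>p choose k\<close> vanish modulo \<open>p\<close>; oddness of \<open>p\<close> fixes the sign
  of the last term.
\<close>

lemma cong_upto_frobenius_factor:
  assumes "prime p" "odd p"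
  shows "cong_upto N (int p) ((1 - x) ^ p) (1 - x ^ p)"
proof -
  have p: "p > 0" using assms prime_gt_0_nat by blast
  have "(1 - x) ^ p = (\<Sum>k\<le>p. of_nat (p choose k) * (- x) ^ k)"
    using binomial_ring[of "- x" 1 p] by simp
  also have "\<dots> = (\<Sum>k\<in>insert 0 (insert p {1..<p}). of_nat (p choose k) * (- x) ^ k)"
    using p by (intro sum.cong) auto
  also have "\<dots> = 1 - x ^ p + (\<Sum>k\<in>{1..<p}. of_nat (p choose k) * (- x) ^ k)"
    using p assms(2) by simp
  finally have eq: "(1 - x) ^ p = 1 - x ^ p + (\<Sum>k\<in>{1..<p}. of_nat (p choose k) * (- x) ^ k)" .
  have "[fps_nth (\<Sum>k\<in>{1..<p}. of_nat (p choose k) * (- x) ^ k) n = 0] (mod int p)" for n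
    unfolding cong_0_iff fps_sum_nth
  proof (rule dvd_sum)
    fix k assume "k \<in> {1..<p}"
    then have "p dvd (p choose k)"
      using assms by (intro dvd_choose_prime) auto
    then show "int p dvd fps_nth (of_nat (p choose k) * (- x) ^ k) n"
      by (simp add: fps_of_nat[symmetric] fps_mult_left_const_nth)
  qed
  then have "[fps_nth (1 - x ^ p) n + fps_nth (\<Sum>k\<in>{1..<p}. of_nat (p choose k) * (- x) ^ k) n =
      fps_nth (1 - x ^ p) n + 0] (mod int p)" for n
    by (intro cong_add cong_refl)
  then show ?thesis
    unfolding cong_upto_def eq fps_add_nth by simp
qed

lemma cong_upto_frobenius_factor_power:
  assumes "prime p" "odd p"
  shows "cong_upto N (int p) ((1 - x) ^ (p ^ i)) (1 - x ^ (p ^ i))"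
proof (induction i)
  case (Suc i)
  have "cong_upto N (int p) (((1 - x) ^ (p ^ i)) ^ p) ((1 - x ^ (p ^ i)) ^ p)"
    by (rule cong_upto_power[OF Suc])
  also have "cong_upto N (int p) \<dots> (1 - (x ^ (p ^ i)) ^ p)"
    by (rule cong_upto_frobenius_factor[OF assms])
  finally show ?case
    by (simp only: power_mult[symmetric] power_Suc2)
qed simp

lemma euler_prod_frobenius:
  assumes "prime p" "odd p"
  shows "cong_upto N (int p) (euler_prod 1 ^ (p ^ i)) (euler_prod (p ^ i))"
proof -
  have pos: "p ^ i > 0" using assms prime_gt_0_nat by auto
  have "cong_upto N (int p) (euler_prod 1 ^ (p ^ i)) ((\<Prod>j=1..Suc N. 1 - fps_X ^ (1 * j)) ^ (p ^ i))"
    by (rule cong_upto_power[OF cong_upto_if_exact[OF euler_prod_cong_upto]]) auto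
  also have "(\<Prod>j=1..Suc N. 1 - (fps_X :: int fps) ^ (1 * j)) ^ (p ^ i) =
      (\<Prod>j=1..Suc N. (1 - fps_X ^ (1 * j)) ^ (p ^ i))"
    by (rule prod_power_distrib)
  also have "cong_upto N (int p) \<dots> (\<Prod>j=1..Suc N. 1 - (fps_X ^ (1 * j)) ^ (p ^ i))"
    by (intro cong_upto_prod cong_upto_frobenius_factor_power assms)
  also have "(\<Prod>j=1..Suc N. 1 - ((fps_X :: int fps) ^ (1 * j)) ^ (p ^ i)) =
      (\<Prod>j=1..Suc N. 1 - fps_X ^ (p ^ i * j))"
    by (simp only: mult_1 mult_1_right power_mult[symmetric] mult.commute)
  also have "cong_upto N (int p) \<dots> (euler_prod (p ^ i))"
    using pos by (intro cong_upto_sym[OF cong_upto_if_exact[OF euler_prod_cong_upto]]) auto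
  finally show ?thesis .
qed

section \<open>Dilation and sections\<close>

lemma fps_compose_X_power_nth:
  fixes F :: "int fps"
  assumes "m > 0"
  shows "fps_nth (F oo fps_X ^ m) n = (if m dvd n then fps_nth F (n div m) else 0)"
proof -
  have "fps_nth (F oo fps_X ^ m) n = (\<Sum>i=0..n. if n = m * i then fps_nth F i else 0)"
    by (auto simp: fps_compose_nth simp flip: power_mult intro!: sum.cong)
  also have "\<dots> = (if m dvd n then fps_nth F (n div m) else 0)"
  proof (cases "m dvd n")
    case True
    then have "(n = m * i) = (i = n div m)" for i
      using assms by auto
    then show ?thesis
      using True by simp
  qed (auto intro!: sum.neutral)
  finally show ?thesis .
qed

lemma euler_prod_dilate:
  assumes "m > 0"
  shows "euler_prod m = euler_prod 1 oo fps_X ^ m"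
proof (rule fps_ext)
  fix n
  let ?P = "\<Prod>i=1..Suc n. 1 - (fps_X :: int fps) ^ (1 * i)"
  have comp: "?P oo fps_X ^ m = (\<Prod>i=1..Suc n. 1 - fps_X ^ (m * i))"
    using assms
    by (subst fps_compose_prod_distrib)
      (auto simp: fps_compose_sub_distrib fps_X_power_compose simp flip: power_mult
            simp del: prod.cl_ivl_Suc)
  have "fps_nth (euler_prod m) n = fps_nth (?P oo fps_X ^ m) n"
    using euler_prod_cong_upto[OF assms, of n "Suc n"] unfolding comp
    by (simp add: cong_upto_def del: prod.cl_ivl_Suc)
  also have "\<dots> = fps_nth (euler_prod 1 oo fps_X ^ m) n"
  proof -
    have "n div m \<le> n" by simp
    then have "fps_nth (euler_prod 1) (n div m) = fps_nth ?P (n div m)"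
      using euler_prod_cong_upto[of 1 n "Suc n"]
      by (simp add: cong_upto_def del: prod.cl_ivl_Suc)
    then show ?thesis
      by (simp only: fps_compose_X_power_nth[OF assms])
  qed
  finally show "fps_nth (euler_prod m) n = fps_nth (euler_prod 1 oo fps_X ^ m) n" .
qed

definition fps_section :: "nat \<Rightarrow> nat \<Rightarrow> int fps \<Rightarrow> int fps" where
  "fps_section m r F = Abs_fps (\<lambda>n. fps_nth F (m * n + r))"

text \<open>
  A factor that is a series in \<open>X^m\<close> can be pulled out of the extraction of the coefficients in
  the residue class of \<open>r\<close> modulo \<open>m\<close>. For \<open>r \<ge> m\<close> the section starts inside its residue class,
  and the product would also see the coefficients of \<open>F\<close> in that class below \<open>r\<close>; hence the
  assumption that these vanish.
\<close>

lemma fps_section_mult_dilate: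
  assumes m: "m > 0" and vanish: "\<And>i. i < r \<Longrightarrow> m dvd r - i \<Longrightarrow> fps_nth F i = 0"
  shows "fps_section m r (F * (G oo fps_X ^ m)) = fps_section m r F * G"
proof (rule fps_ext)
  fix n
  have "fps_nth (fps_section m r (F * (G oo fps_X ^ m))) n =
      (\<Sum>i=0..m * n + r. fps_nth (G oo fps_X ^ m) i * fps_nth F (m * n + r - i))"
    by (simp add: fps_section_def fps_mult_nth mult.commute[of F])
  also have "\<dots> = (\<Sum>i\<in>(*) m ` {0..n}. fps_nth (G oo fps_X ^ m) i * fps_nth F (m * n + r - i))"
  proof (rule sum.mono_neutral_right)
    show "(*) m ` {0..n} \<subseteq> {0..m * n + r}"
      by (auto intro!: trans_le_add1 mult_le_mono2)
    show "\<forall>i\<in>{0..m * n + r} - (*) m ` {0..n}.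
        fps_nth (G oo fps_X ^ m) i * fps_nth F (m * n + r - i) = 0"
    proof
      fix i assume i: "i \<in> {0..m * n + r} - (*) m ` {0..n}"
      show "fps_nth (G oo fps_X ^ m) i * fps_nth F (m * n + r - i) = 0"
      proof (cases "m dvd i")
        case True
        then obtain j where j: "i = m * j" by blast
        then have "n < j" using i by (auto simp: not_le[symmetric])
        then have gt: "m * n < i" using j m by simp
        have "r - (m * n + r - i) = m * (j - n)"
          using i j gt by (auto simp: diff_mult_distrib2)
        then have "fps_nth F (m * n + r - i) = 0"
          using gt i by (intro vanish) auto
        then show ?thesis by simp
      qed (simp add: fps_compose_X_power_nth[OF m])
    qed
  qed simp
  also have "\<dots> = (\<Sum>i=0..n. fps_nth G i * fps_nth F (m * (n - i) + r))"
    using m by (subst sum.reindex)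
      (auto simp: inj_on_def fps_compose_X_power_nth[OF m] algebra_simps diff_mult_distrib2
            intro!: sum.cong arg_cong[of _ _ "fps_nth F"])
  also have "\<dots> = fps_nth (fps_section m r F * G) n"
    by (simp add: mult.commute[of _ G] fps_mult_nth fps_section_def)
  finally show "fps_nth (fps_section m r (F * (G oo fps_X ^ m))) n =
      fps_nth (fps_section m r F * G) n" .
qed

section \<open>Euler's pentagonal number theorem\<close>

text \<open>
  A finite form of the pentagonal number theorem, due to Shanks. The right-hand side is a partial
  sum of the pentagonal series, with exponents \<open>s * (3 * s + 1) / 2\<close> and \<open>s * (3 * s - 1) / 2\<close>
  expressed by triangular numbers. On the left, the term \<open>s = 0\<close> is the product of all
  \<open>1 - q^i\<close> with \<open>i \<le> n\<close>, while every other term is divisible by \<open>q^(n + 1)\<close>.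

  For the induction, split \<open>1 - q^(n + 1)\<close> off the product of the \<open>s\<close>-th term and write the
  factor \<open>q^s\<close>, by which the power of \<open>q\<close> grows, as \<open>1 - (1 - q^s)\<close>. The \<open>s\<close>-th term for
  \<open>n + 1\<close> becomes the \<open>s\<close>-th term for \<open>n\<close> minus \<open>D s\<close> minus \<open>C s\<close>, where \<open>D (s + 1) = - C s\<close>.
  Everything telescopes except for \<open>C n\<close> and the new last term.
\<close>

lemma shanks_identity:
  fixes q :: "'a :: comm_ring_1"
  shows "(\<Sum>s\<le>n. (- 1) ^ s * (\<Prod>i=Suc s..n. 1 - q ^ i) * q ^ (s * n + \<Sum>{..s})) =
    1 + (\<Sum>s<n. (- 1) ^ Suc s * (q ^ (Suc s * Suc s + \<Sum>{..Suc s}) + q ^ (Suc s * Suc s + \<Sum>{..s})))"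
proof (induction n)
  case (Suc n)
  define A where "A s = (- 1) ^ s * (\<Prod>i=Suc s..n. 1 - q ^ i)" for s
  define C where "C s = A s * q ^ (Suc s * Suc n + \<Sum>{..s})" for s
  define D where "D s = A s * (1 - q ^ s) * q ^ (s * n + \<Sum>{..s})" for s
  have split: "(- 1) ^ s * (\<Prod>i=Suc s..Suc n. 1 - q ^ i) * q ^ (s * Suc n + \<Sum>{..s}) =
      A s * q ^ (s * n + \<Sum>{..s}) - D s - C s" if "s \<le> n" for s
    using that unfolding A_def C_def D_def by (simp add: algebra_simps power_add)
  have D_Suc: "D (Suc s) = - C s" if "s < n" for s
  proof -
    have "(\<Prod>i=Suc s..n. 1 - q ^ i) = (1 - q ^ Suc s) * (\<Prod>i=Suc (Suc s)..n. 1 - q ^ i)"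
      using that by (simp add: prod.atLeast_Suc_atMost)
    then have "A (Suc s) * (1 - q ^ Suc s) = - A s"
      unfolding A_def by (simp add: mult_ac power_Suc[of "- 1"] del: power_Suc)
    moreover have "Suc s * n + \<Sum>{..Suc s} = Suc s * Suc n + \<Sum>{..s}"
      by simp
    ultimately show ?thesis
      unfolding D_def C_def by (simp only: minus_mult_left)
  qed
  have "(\<Sum>s\<le>n. D s) = (\<Sum>s<n. D (Suc s))"
    by (simp add: sum.atMost_shift D_def)
  also have "\<dots> = - (\<Sum>s<n. C s)"
    by (simp add: D_Suc sum_negf)
  finally have "(\<Sum>s\<le>n. D s + C s) = C n"
    by (simp add: sum.distrib flip: lessThan_Suc_atMost)
  also have "C n = (- 1) ^ n * q ^ (Suc n * Suc n + \<Sum>{..n})"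
    by (simp add: C_def A_def)
  finally have DC: "(\<Sum>s\<le>n. D s + C s) = (- 1) ^ n * q ^ (Suc n * Suc n + \<Sum>{..n})" .
  have "(\<Sum>s\<le>Suc n. (- 1) ^ s * (\<Prod>i=Suc s..Suc n. 1 - q ^ i) * q ^ (s * Suc n + \<Sum>{..s})) =
     (\<Sum>s\<le>n. (- 1) ^ s * (\<Prod>i=Suc s..Suc n. 1 - q ^ i) * q ^ (s * Suc n + \<Sum>{..s})) +
     (- 1) ^ Suc n * q ^ (Suc n * Suc n + \<Sum>{..Suc n})"
    by (subst sum.atMost_Suc) simp
  also have "(\<Sum>s\<le>n. (- 1) ^ s * (\<Prod>i=Suc s..Suc n. 1 - q ^ i) * q ^ (s * Suc n + \<Sum>{..s})) =
      (\<Sum>s\<le>n. A s * q ^ (s * n + \<Sum>{..s}) - D s - C s)"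
    by (intro sum.cong refl split) simp
  also have "\<dots> = (\<Sum>s\<le>n. A s * q ^ (s * n + \<Sum>{..s})) - (\<Sum>s\<le>n. D s + C s)"
    by (simp add: sum_subtractf sum.distrib)
  also have "(\<Sum>s\<le>n. A s * q ^ (s * n + \<Sum>{..s})) = 
      1 + (\<Sum>s<n. (- 1) ^ Suc s * (q ^ (Suc s * Suc s + \<Sum>{..Suc s}) + q ^ (Suc s * Suc s + \<Sum>{..s})))"
    unfolding A_def by (rule Suc)
  finally show ?case
    unfolding DC sum.lessThan_Suc by (simp only: distrib_left power_Suc) (simp add: algebra_simps)
qed simp

abbreviation int_parity_sign :: "int \<Rightarrow> int" where
  "int_parity_sign j \<equiv> (- 1) ^ nat \<bar>j\<bar>"

lemma int_parity_sign_eq: "int_parity_sign j = (if even j then 1 else - 1)"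
  by (auto simp: even_nat_iff minus_one_power_iff)

lemma two_times_triangle: "2 * int (\<Sum>{..s}) = int s * (int s + 1)"
  by (induction s) (auto simp: algebra_simps)

text \<open>
  Taking \<open>n = N + 1\<close> in Shanks' identity removes all terms on the left but the first one. The two
  powers in the \<open>s\<close>-th summand on the right belong to the indices \<open>j = - s\<close> and \<open>j = s\<close>.
\<close>

theorem pentagonal_number_theorem:
  "fps_nth (euler_prod 1) N = (\<Sum>j | j * (3 * j - 1) = 2 * int N. int_parity_sign j)"
proof -
  define g where "g j = (if j * (3 * j - 1) = 2 * int N then int_parity_sign j else 0)" for j
  let ?n = "Suc N"
  have pos: "s * ?n + \<Sum>{..s} > N" if "s > 0" for s
    using that by (cases s) auto
  have "fps_nth (euler_prod 1) N = fps_nth (\<Prod>i=1..?n. 1 - fps_X ^ (1 * i)) N"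
    using euler_prod_cong_upto[of 1 N "Suc N"] by (simp add: cong_upto_def del: prod.cl_ivl_Suc)
  also have "\<dots> = (\<Sum>s\<in>{0}. fps_nth ((- 1) ^ s * (\<Prod>i=Suc s..?n. 1 - fps_X ^ i) * fps_X ^ (s * ?n + \<Sum>{..s})) N)"
    by simp
  also have "\<dots> = (\<Sum>s\<le>?n. fps_nth ((- 1) ^ s * (\<Prod>i=Suc s..?n. 1 - fps_X ^ i) * fps_X ^ (s * ?n + \<Sum>{..s})) N)"
    using pos by (intro sum.mono_neutral_left) (auto simp: fps_X_power_mult_right_nth simp del: prod.cl_ivl_Suc)
  also have "\<dots> = fps_nth (1 + (\<Sum>s<?n. (- 1) ^ Suc s * (fps_X ^ (Suc s * Suc s + \<Sum>{..Suc s}) + fps_X ^ (Suc s * Suc s + \<Sum>{..s})))) N"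
    by (simp only: shanks_identity flip: fps_sum_nth)
  also have "\<dots> = (\<Sum>j\<in>{-int n..int n}. g j)" if "n = ?n" for n
    unfolding that[symmetric]
  proof (induction n)
    case 0
    then show ?case by (auto simp: g_def)
  next
    case (Suc n)
    have sq: "int n * int n = 2 * int (\<Sum>{..n}) - int n"
      using two_times_triangle[of n] by (simp add: algebra_simps)
    have pm: "fps_nth ((- 1) ^ Suc n * F) N = int_parity_sign (1 + int n) * fps_nth F N" for F :: "int fps"
    proof -
      have "(- 1 :: int fps) ^ Suc n = fps_const ((- 1) ^ Suc n)"
        by (simp only: fps_const_power[symmetric] fps_const_neg[symmetric] fps_const_1_eq_1)
      moreover have "nat \<bar>1 + int n\<bar> = Suc n" by simp
      ultimately show ?thesis by (simp only: fps_mult_left_const_nth)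
    qed
    have gp: "g (1 + int n) = int_parity_sign (1 + int n) * fps_nth (fps_X ^ (Suc n * Suc n + \<Sum>{..n})) N"
    proof -
      obtain e where e: "e = Suc n * Suc n + \<Sum>{..n}" by simp
      have eq: "(1 + int n) * (3 * (1 + int n) - 1) = 2 * int e"
        unfolding e using sq by (simp add: algebra_simps)
      show ?thesis unfolding g_def eq fps_X_power_nth e[symmetric] by simp
    qed
    have gm: "g (- (1 + int n)) = int_parity_sign (1 + int n) * fps_nth (fps_X ^ (Suc n * Suc n + \<Sum>{..Suc n})) N"
    proof -
      obtain e where e: "e = Suc n * Suc n + \<Sum>{..Suc n}" by simp
      have eq: "- (1 + int n) * (3 * - (1 + int n) - 1) = 2 * int e"
        unfolding e using sq by (simp add: algebra_simps)
      show ?thesis unfolding g_def eq fps_X_power_nth e[symmetric] abs_minus_cancel by simp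
    qed
    have "{- int (Suc n)..int (Suc n)} = insert (1 + int n) (insert (- (1 + int n)) {- int n..int n})"
      by auto
    then have "(\<Sum>j\<in>{- int (Suc n)..int (Suc n)}. g j) =
        g (1 + int n) + g (- (1 + int n)) + (\<Sum>j\<in>{- int n..int n}. g j)"
      by simp
    then show ?case
      unfolding sum.lessThan_Suc Suc.IH[symmetric] gp gm fps_add_nth[of _ "_ * _"] 
        add.assoc[symmetric] pm by (simp add: algebra_simps)
  qed
  also have "(\<Sum>j\<in>{-int ?n..int ?n}. g j) = (\<Sum>j | j * (3 * j - 1) = 2 * int N. int_parity_sign j)"
  proof (rule sum.mono_neutral_cong_right)
    show "{j. j * (3 * j - 1) = 2 * int N} \<subseteq> {- int ?n..int ?n}"
    proof
      fix j :: int assume j: "j \<in> {j. j * (3 * j - 1) = 2 * int N}"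
      show "j \<in> {- int ?n..int ?n}"
      proof (cases "j = 0")
        case False
        then have "\<bar>j\<bar> * 2 \<le> \<bar>j\<bar> * \<bar>3 * j - 1\<bar>"
          by (intro mult_left_mono) auto
        also have "\<dots> = 2 * int N" using j by (simp flip: abs_mult)
        finally show ?thesis by auto
      qed simp
    qed
  qed (auto simp: g_def)
  finally show ?thesis by simp
qed

section \<open>Dissection of the pentagonal series\<close>

text \<open>
  The quantity \<open>(w - 1) / 6\<close> modulo \<open>2\<close> is additive on products of integers \<open>w\<close> that are
  congruent to \<open>1\<close> modulo \<open>6\<close>.
\<close>

lemma int_parity_sign_power:
  fixes r :: int
  obtains m where "(6 * r + 1) ^ a = 6 * m + 1" "int_parity_sign m = int_parity_sign r ^ a"
proof -
  have "\<exists>m. (6 * r + 1) ^ a = 6 * m + 1 \<and> int_parity_sign m = int_parity_sign r ^ a"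
  proof (induction a)
    case 0
    then show ?case by (intro exI[of _ 0]) simp
  next
    case (Suc a)
    then obtain m where m: "(6 * r + 1) ^ a = 6 * m + 1" "int_parity_sign m = int_parity_sign r ^ a"
      by blast
    have "(6 * r + 1) ^ Suc a = 6 * (6 * m * r + m + r) + 1"
      by (simp only: power_Suc m(1)) (simp add: algebra_simps)
    moreover have "int_parity_sign (6 * m * r + m + r) = int_parity_sign r ^ Suc a"
      unfolding power_Suc m(2)[symmetric] unfolding int_parity_sign_eq by auto
    ultimately show ?case by blast
  qed
  then show ?thesis using that by blast
qed

lemma prime_mod_6:
  fixes p :: nat
  assumes "prime p" "p \<ge> 5"
  shows "p mod 6 = 1 \<or> p mod 6 = 5"
proof -
  have "\<not> 2 dvd p" "\<not> 3 dvd p"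
    using assms primes_dvd_imp_eq[of 2 p] primes_dvd_imp_eq[of 3 p] by auto
  then show ?thesis by presburger
qed

lemma pm_sign_times_prime:
  assumes "prime p" "p \<ge> 5"
  obtains r where "pm_sign p * int p = 6 * r + 1" "quad_sign p = int_parity_sign r"
proof -
  define r where "r = (pm_sign p * int p - 1) div 6"
  have "6 dvd (pm_sign p * int p - 1)"
    using prime_mod_6[OF assms] unfolding pm_sign_def cong_def by (auto simp: zmod_int) presburger+
  then have "pm_sign p * int p = 6 * r + 1"
    unfolding r_def by simp
  moreover have "quad_sign p = int_parity_sign r"
    by (simp add: quad_sign_def r_def)
  ultimately show ?thesis using that by blast
qed

text \<open>The multiplicity of \<open>p\<close> in a square is even, so \<open>2 * a - 1\<close> can be improved to \<open>2 * a\<close>.\<close>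

lemma prime_power_dvd_square:
  fixes x :: int
  assumes "prime p" "a \<ge> 1" "p ^ (2 * a - 1) dvd x ^ 2"
  shows "p ^ a dvd x"
proof (cases "x = 0")
  case False
  have "\<not> is_unit p" "x ^ 2 \<noteq> 0" using assms False by auto
  then have "2 * a - 1 \<le> multiplicity p (x ^ 2)"
    using assms(3) power_dvd_iff_le_multiplicity by metis
  also have "\<dots> = 2 * multiplicity p x"
    using assms(1) False by (intro prime_elem_multiplicity_power_distrib prime_imp_prime_elem)
  finally have "a \<le> multiplicity p x"
    using assms(2) by linarith
  then show ?thesis
    by (rule multiplicity_dvd')
qed simp

text \<open>
  Let \<open>w\<close> be that one of \<open>p^a\<close> and \<open>- p^a\<close> which is congruent to \<open>1\<close> modulo \<open>6\<close>, and write
  \<open>w = 6 * m + 1\<close>. The pentagonal indices \<open>j\<close> of \<open>k * n + c\<close> are exactly those with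
  \<open>6 * j - 1 = w * (6 * i - 1)\<close>, that is \<open>j = w * i - m\<close>, where \<open>i\<close> is a pentagonal index of
  \<open>n / p\<close>. As \<open>w\<close> is odd, \<open>j\<close> and \<open>i + m\<close> have the same parity, so the signs differ by \<open>(-1)^m\<close>.
\<close>

lemma euler_prod_section:
  assumes "prime p" "p \<ge> 5" "a \<ge> 1" "k = p ^ (2 * a - 1)" "24 * c + 1 = p ^ (2 * a)"
  shows "fps_section k c (euler_prod 1) = fps_const (quad_sign p ^ a) * euler_prod p"
proof (rule fps_ext)
  fix n
  obtain r where r: "pm_sign p * int p = 6 * r + 1" "quad_sign p = int_parity_sign r"
    using pm_sign_times_prime assms by blast
  obtain m where m: "(6 * r + 1) ^ a = 6 * m + 1" "int_parity_sign m = int_parity_sign r ^ a"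
    using int_parity_sign_power by blast
  define w where "w = 6 * m + 1"
  have pm2: "pm_sign p ^ 2 = 1" by (simp add: pm_sign_def)
  have w_eq: "w = pm_sign p ^ a * int p ^ a"
    by (simp add: w_def m(1)[symmetric] r(1)[symmetric] power_mult_distrib)
  have unit: "is_unit (pm_sign p ^ a)" by (simp add: pm_sign_def)
  have ppos: "p > 0" using assms(2) by simp
  have "w ^ 2 = (pm_sign p ^ 2) ^ a * int p ^ (2 * a)"
    unfolding w_eq power_mult_distrib by (simp flip: power_mult add: mult.commute)
  then have w2: "w ^ 2 = int p ^ (2 * a)" by (simp add: pm2)
  have "2 * a = Suc (2 * a - 1)" using assms(3) by simp
  then have w2': "w ^ 2 = int p * int k"
    unfolding w2 assms(4) of_nat_power by (metis power_Suc)
  have w0: "w \<noteq> 0" using w2 ppos by auto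
  have k0: "int k \<noteq> 0" using assms(4) ppos by simp
  have c24: "24 * int c + 1 = w ^ 2"
    using arg_cong[OF assms(5), of int] by (simp add: w2)
  \<comment> \<open>Completing the square, with \<open>w^2 = 24 * c + 1\<close>.\<close>
  have sq: "j * (3 * j - 1) = 2 * int (k * n + c) \<longleftrightarrow> (6 * j - 1) ^ 2 = 24 * int k * int n + w ^ 2" for j
  proof -
    have "(6 * j - 1) ^ 2 = 12 * (j * (3 * j - 1)) + 1"
      by (simp add: power2_eq_square algebra_simps)
    then show ?thesis using c24 by auto
  qed
  have shift: "(w * i - m) * (3 * (w * i - m) - 1) = 2 * int (k * n + c) \<longleftrightarrow> 
      int p * (i * (3 * i - 1)) = 2 * int n" for i
  proof -
    have "6 * (w * i - m) - 1 = w * (6 * i - 1)"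
      by (simp add: w_def algebra_simps)
    then have "(6 * (w * i - m) - 1) ^ 2 = 12 * w ^ 2 * (i * (3 * i - 1)) + w ^ 2"
      by (simp add: power2_eq_square algebra_simps)
    also have "12 * w ^ 2 * (i * (3 * i - 1)) = 12 * int k * (int p * (i * (3 * i - 1)))"
      by (simp add: w2')
    finally have eq: "(6 * (w * i - m) - 1) ^ 2 = 12 * int k * (int p * (i * (3 * i - 1))) + w ^ 2" .
    have "24 * int k * int n = 12 * int k * (2 * int n)" by simp
    then show ?thesis
      unfolding sq eq using k0 by (simp only: add_right_cancel mult_cancel_left) simp
  qed
  have "{j. j * (3 * j - 1) = 2 * int (k * n + c)} =
      (\<lambda>i. w * i - m) ` {i. int p * (i * (3 * i - 1)) = 2 * int n}"
  proof (intro equalityI subsetI)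
    fix j assume "j \<in> {j. j * (3 * j - 1) = 2 * int (k * n + c)}"
    then have j: "j * (3 * j - 1) = 2 * int (k * n + c)" by simp
    have "(6 * j - 1) ^ 2 = int k * (24 * int n + int p)"
      using j unfolding sq w2' by (simp add: algebra_simps)
    then have "int k dvd (6 * j - 1) ^ 2"
      by (rule dvdI)
    then have "int p ^ (2 * a - 1) dvd (6 * j - 1) ^ 2"
      by (simp only: assms(4) of_nat_power)
    then have "int p ^ a dvd 6 * j - 1"
      by (rule prime_power_dvd_square[rotated 2]) (use assms(1,3) in simp_all)
    then have "w dvd 6 * j - 1"
      unfolding w_eq using unit by (simp add: mult_unit_dvd_iff')
    then obtain t where t: "6 * j - 1 = w * t" by blast
    then have "t + 1 = 6 * (j - m * t)"
      by (simp add: w_def algebra_simps)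
    then obtain i where i: "t = 6 * i - 1"
      by (metis add_diff_cancel_right')
    have "6 * j = 6 * (w * i - m)"
      using t unfolding i by (simp add: w_def algebra_simps)
    then have "j = w * i - m" by simp
    then show "j \<in> (\<lambda>i. w * i - m) ` {i. int p * (i * (3 * i - 1)) = 2 * int n}"
      using j shift by blast
  qed (use shift in auto)
  then have "fps_nth (euler_prod 1) (k * n + c) =
      (\<Sum>j\<in>(\<lambda>i. w * i - m) ` {i. int p * (i * (3 * i - 1)) = 2 * int n}. int_parity_sign j)"
    by (simp only: pentagonal_number_theorem)
  also have "\<dots> = (\<Sum>i | int p * (i * (3 * i - 1)) = 2 * int n. int_parity_sign (w * i - m))"
    using w0 by (subst sum.reindex) (auto simp: inj_on_def)
  also have "\<dots> = (\<Sum>i | int p * (i * (3 * i - 1)) = 2 * int n. quad_sign p ^ a * int_parity_sign i)"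
  proof (rule sum.cong)
    fix i
    show "int_parity_sign (w * i - m) = quad_sign p ^ a * int_parity_sign i"
      unfolding r(2) m(2)[symmetric] unfolding int_parity_sign_eq by (auto simp: w_def)
  qed simp
  also have "\<dots> = quad_sign p ^ a * (\<Sum>i | int p * (i * (3 * i - 1)) = 2 * int n. int_parity_sign i)"
    by (simp add: sum_distrib_left)
  also have "(\<Sum>i | int p * (i * (3 * i - 1)) = 2 * int n. int_parity_sign i) = fps_nth (euler_prod p) n"
  proof (cases "p dvd n")
    case True
    then obtain l where "n = p * l" by blast
    then show ?thesis
      using ppos by (simp add: euler_prod_dilate[OF ppos] fps_compose_X_power_nth
        pentagonal_number_theorem[unfolded One_nat_def])
  next
    case False
    \<comment> \<open>A solution would give \<open>p dvd 2 * n\<close>, hence \<open>p dvd n\<close> as \<open>p\<close> is odd.\<close>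
    have "int p * (i * (3 * i - 1)) \<noteq> 2 * int n" for i
    proof
      assume "int p * (i * (3 * i - 1)) = 2 * int n"
      then have "int p dvd int (2 * n)" by (metis dvd_triv_left of_nat_mult of_nat_numeral)
      then have "p dvd 2 * n" by (simp only: int_dvd_int_iff)
      then have "p dvd 2" using False assms(1) prime_dvd_mult_iff by blast
      then show False using assms(2) dvd_imp_le[of p 2] by simp
    qed
    then show ?thesis
      using False ppos by (simp add: euler_prod_dilate[OF ppos] fps_compose_X_power_nth)
  qed
  finally show "fps_nth (fps_section k c (euler_prod 1)) n =
      fps_nth (fps_const (quad_sign p ^ a) * euler_prod p) n"
    by (simp add: fps_section_def)
qed

text \<open>
  The number \<open>c\<close> may exceed \<open>k\<close>, so the section of \<open>f\<^sub>1\<close> at \<open>c\<close> might start too late and miss some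
  coefficients. It does not: if the coefficient at an index \<open>i\<close> in the same class is nonzero, then
  \<open>k\<close> divides \<open>24 * i + 1 = (6 * j - 1)^2\<close> for some \<open>j\<close>, hence so does \<open>p^(2 * a) = 24 * c + 1\<close>,
  and \<open>i \<ge> c\<close>.
\<close>

lemma euler_prod_nth_eq_0:
  assumes "prime p" "p \<ge> 5" "a \<ge> 1" "k = p ^ (2 * a - 1)" "24 * c + 1 = p ^ (2 * a)"
    and "i < c" "k dvd c - i"
  shows "fps_nth (euler_prod 1) i = 0"
proof -
  have "2 * a = Suc (2 * a - 1)" using assms(3) by simp
  then have pk: "p ^ (2 * a) = p * k" unfolding assms(4) by (metis power_Suc)
  have "j * (3 * j - 1) \<noteq> 2 * int i" for j
  proof
    assume "j * (3 * j - 1) = 2 * int i"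
    then have sq: "(6 * j - 1) ^ 2 = 24 * int i + 1"
      by (simp add: power2_eq_square algebra_simps)
    have "24 * i + 1 = p * k - 24 * (c - i)"
      using assms(5,6) unfolding pk by simp
    then have "k dvd 24 * i + 1"
      using assms(7) by (metis dvd_diff_nat dvd_mult dvd_triv_right)
    then have "int k dvd int (24 * i + 1)" by (simp only: int_dvd_int_iff)
    then have "int p ^ (2 * a - 1) dvd (6 * j - 1) ^ 2"
      unfolding sq assms(4) by (simp add: algebra_simps)
    then have "int p ^ a dvd 6 * j - 1"
      by (rule prime_power_dvd_square[rotated 2]) (use assms(1,3) in simp_all)
    then have "(int p ^ a) ^ 2 dvd (6 * j - 1) ^ 2" by (simp only: dvd_power_same)
    then have "int (p ^ (2 * a)) \<le> 24 * int i + 1"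
      unfolding sq by (intro zdvd_imp_le) (simp_all add: mult.commute flip: power_mult)
    then show False using assms(6) by (simp flip: assms(5))
  qed
  then show ?thesis by (simp add: pentagonal_number_theorem[unfolded One_nat_def])
qed

section \<open>Partition generating functions\<close>

definition partitions_into :: "nat set \<Rightarrow> nat \<Rightarrow> nat multiset set" where
  "partitions_into S n = {M. set_mset M \<subseteq> S \<and> sum_mset M = n}"

definition partitions_into_gf :: "nat set \<Rightarrow> int fps" where
  "partitions_into_gf S = Abs_fps (\<lambda>n. int (card (partitions_into S n)))"

lemma finite_partitions_into:
  assumes "0 \<notin> S"
  shows "finite (partitions_into S n)"
proof (induction n rule: less_induct)
  case (less n)
  have "partitions_into S n \<subseteq> insert {#} (\<Union>s\<in>{1..n}. add_mset s ` partitions_into S (n - s))"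
  proof
    fix M assume M: "M \<in> partitions_into S n"
    show "M \<in> insert {#} (\<Union>s\<in>{1..n}. add_mset s ` partitions_into S (n - s))"
    proof (cases M)
      case (add s M')
      then have "s \<in> {1..n}" "M' \<in> partitions_into S (n - s)"
        using M assms by (auto simp: partitions_into_def Suc_le_eq intro!: gr0I)
      then show ?thesis using add by blast
    qed simp
  qed
  moreover have "finite (insert {#} (\<Union>s\<in>{1..n}. add_mset s ` partitions_into S (n - s)))"
    using less by auto
  ultimately show ?case by (rule finite_subset)
qed

text \<open>
  A partition into parts from \<open>insert s S\<close> either avoids \<open>s\<close>, or arises by adding one part \<open>s\<close>
  to another such partition.
\<close>

lemma partitions_into_gf_insert:
  assumes "0 \<notin> S" "s > 0" "s \<notin> S"
  shows "partitions_into_gf (insert s S) * (1 - fps_X ^ s) = partitions_into_gf S"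
proof -
  let ?T = "insert s S"
  have "partitions_into_gf ?T = partitions_into_gf S + fps_X ^ s * partitions_into_gf ?T"
  proof (rule fps_ext)
    fix n
    have fin: "finite (partitions_into S n)" "finite (partitions_into ?T i)" for i
      using assms by (auto intro!: finite_partitions_into)
    show "fps_nth (partitions_into_gf ?T) n =
        fps_nth (partitions_into_gf S + fps_X ^ s * partitions_into_gf ?T) n"
    proof (cases "n < s")
      case True
      have "s \<notin># M" if "sum_mset M = n" for M
        using True that by (auto dest!: multi_member_split)
      then have "partitions_into ?T n = partitions_into S n"
        unfolding partitions_into_def by auto
      then show ?thesis
        using True by (simp add: partitions_into_gf_def fps_X_power_mult_nth)
    next
      case False
      have "partitions_into ?T n = partitions_into S n \<union> add_mset s ` partitions_into ?T (n - s)"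
      proof (intro equalityI subsetI)
        fix M assume M: "M \<in> partitions_into ?T n"
        show "M \<in> partitions_into S n \<union> add_mset s ` partitions_into ?T (n - s)"
        proof (cases "s \<in># M")
          case True
          then obtain M' where "M = add_mset s M'" by (blast dest: multi_member_split)
          then show ?thesis using M by (auto simp: partitions_into_def)
        qed (use M in \<open>auto simp: partitions_into_def\<close>)
      qed (use False in \<open>auto simp: partitions_into_def\<close>)
      moreover have "s \<notin># M" if "M \<in> partitions_into S n" for M
        using that assms(3) by (auto simp only: partitions_into_def)
      then have "partitions_into S n \<inter> add_mset s ` partitions_into ?T (n - s) = {}"
        by (metis disjoint_iff imageE union_single_eq_member)
      ultimately have "card (partitions_into ?T n) =
          card (partitions_into S n) + card (partitions_into ?T (n - s))"
        using fin by (simp add: card_Un_disjoint card_image inj_on_def)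
      then show ?thesis
        using False by (simp add: partitions_into_gf_def fps_X_power_mult_nth)
    qed
  qed
  then show ?thesis by (simp add: algebra_simps)
qed

lemma partitions_into_gf_times_prod:
  assumes "finite S" "0 \<notin> S"
  shows "partitions_into_gf S * (\<Prod>s\<in>S. 1 - fps_X ^ s) = 1"
  using assms
proof (induction S rule: finite_induct)
  case empty
  have "partitions_into {} n = (if n = 0 then {{#}} else {})" for n
    by (auto simp: partitions_into_def)
  then show ?case
    by (simp add: partitions_into_gf_def fps_eq_iff)
next
  case (insert s S)
  have "partitions_into_gf (insert s S) * (\<Prod>s\<in>insert s S. 1 - fps_X ^ s) =
      partitions_into_gf (insert s S) * (1 - fps_X ^ s) * (\<Prod>s\<in>S. 1 - fps_X ^ s)"
    using insert.hyps by (simp add: mult.assoc)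
  also have "\<dots> = 1"
    using insert by (subst partitions_into_gf_insert) auto
  finally show ?case .
qed

lemma cong_upto_partitions_into_gf:
  assumes "S \<inter> {..N} = T \<inter> {..N}"
  shows "cong_upto N 0 (partitions_into_gf S) (partitions_into_gf T)"
proof -
  have "partitions_into S n = partitions_into T n" if n: "n \<le> N" for n
  proof -
    have "set_mset M \<subseteq> {..N}" if "sum_mset M = n" for M
      using that n by (auto dest!: multi_member_split)
    then have "set_mset M \<subseteq> S \<longleftrightarrow> set_mset M \<subseteq> T" if "sum_mset M = n" for M
      using that assms by (metis Int_subset_iff)
    then show ?thesis unfolding partitions_into_def by auto
  qed
  then show ?thesis
    by (simp add: cong_upto_def partitions_into_gf_def)
qed

lemma num_partitions_gf:
  "Abs_fps (\<lambda>n. int (num_partitions n)) = partitions_into_gf {0<..}"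
proof -
  have "partitions_of n = partitions_into {0<..} n" for n
    unfolding partitions_of_def partitions_into_def by (auto intro!: gr0I)
  then show ?thesis
    by (simp add: num_partitions_def partitions_into_gf_def)
qed

lemma num_regular_partitions_gf:
  "Abs_fps (\<lambda>n. int (num_regular_partitions l n)) = partitions_into_gf {i. i > 0 \<and> \<not> l dvd i}"
proof -
  have "{M \<in> partitions_of n. \<forall>x\<in>#M. \<not> l dvd x} = partitions_into {i. i > 0 \<and> \<not> l dvd i} n" for n
    unfolding partitions_of_def partitions_into_def by (auto intro!: gr0I)
  then show ?thesis
    by (simp add: num_regular_partitions_def partitions_into_gf_def)
qed

lemma num_partitions_gf_times_euler_prod:
  "Abs_fps (\<lambda>n. int (num_partitions n)) * euler_prod 1 = 1"
proof (rule fps_eqI_cong_upto)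
  fix N
  have "cong_upto N 0 (Abs_fps (\<lambda>n. int (num_partitions n)) * euler_prod 1)
     (partitions_into_gf {1..Suc N} * (\<Prod>i=1..Suc N. 1 - fps_X ^ (1 * i)))"
    unfolding num_partitions_gf
    by (intro cong_upto_mult cong_upto_partitions_into_gf euler_prod_cong_upto) auto
  also have "partitions_into_gf {1..Suc N} * (\<Prod>i=1..Suc N. 1 - fps_X ^ (1 * i)) = 1"
    using partitions_into_gf_times_prod[of "{1..Suc N}"] by (simp del: prod.cl_ivl_Suc)
  finally show "cong_upto N 0 (Abs_fps (\<lambda>n. int (num_partitions n)) * euler_prod 1) 1" .
qed

text \<open>
  The factors of \<open>f\<^sub>1\<close> at the multiples of \<open>l\<close> make up \<open>f\<^sub>l\<close>; the other ones cancel against the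
  generating function.
\<close>

lemma num_regular_partitions_gf_times_euler_prod:
  assumes "l > 0"
  shows "Abs_fps (\<lambda>n. int (num_regular_partitions l n)) * euler_prod 1 = euler_prod l"
proof (rule fps_eqI_cong_upto)
  fix N
  \<comment> \<open>Truncation at a multiple of \<open>l\<close> leaves exactly the first \<open>N + 1\<close> factors of \<open>f\<^sub>l\<close>.\<close>
  let ?M = "l * Suc N"
  let ?S = "{i \<in> {1..?M}. \<not> l dvd i}"
  have MN: "N < ?M" using assms by (cases l) auto
  have split: "{1..?M} = ?S \<union> (*) l ` {1..Suc N}"
    using assms by (auto elim!: dvdE simp del: mult_Suc_right)
  have "(\<Prod>i=1..?M. 1 - (fps_X :: int fps) ^ (1 * i)) =
      (\<Prod>i\<in>?S. 1 - fps_X ^ i) * (\<Prod>i\<in>(*) l ` {1..Suc N}. 1 - fps_X ^ i)"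
    by (subst split, subst prod.union_disjoint) auto
  also have "(\<Prod>i\<in>(*) l ` {1..Suc N}. 1 - (fps_X :: int fps) ^ i) = (\<Prod>i=1..Suc N. 1 - fps_X ^ (l * i))"
    using assms by (subst prod.reindex) (auto simp: inj_on_def simp del: prod.cl_ivl_Suc)
  finally have prod: "(\<Prod>i=1..?M. 1 - (fps_X :: int fps) ^ (1 * i)) =
      (\<Prod>i\<in>?S. 1 - fps_X ^ i) * (\<Prod>i=1..Suc N. 1 - fps_X ^ (l * i))" .
  have "cong_upto N 0 (Abs_fps (\<lambda>n. int (num_regular_partitions l n)) * euler_prod 1)
     (partitions_into_gf ?S * (\<Prod>i=1..?M. 1 - fps_X ^ (1 * i)))"
    unfolding num_regular_partitions_gf
    using MN by (intro cong_upto_mult cong_upto_partitions_into_gf euler_prod_cong_upto) auto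
  also have "partitions_into_gf ?S * (\<Prod>i=1..?M. 1 - fps_X ^ (1 * i)) = (\<Prod>i=1..Suc N. 1 - fps_X ^ (l * i))"
    unfolding prod mult.assoc[symmetric] by (subst partitions_into_gf_times_prod) auto
  also have "cong_upto N 0 \<dots> (euler_prod l)"
    using assms by (intro cong_upto_sym[OF euler_prod_cong_upto]) auto
  finally show "cong_upto N 0 (Abs_fps (\<lambda>n. int (num_regular_partitions l n)) * euler_prod 1)
     (euler_prod l)" .
qed

section \<open>The bracelet congruences\<close>

text \<open>
  Multiplying the defining identity by \<open>f\<^sub>1 f\<^sub>k\<close> turns it into the exact equation
  \<open>bracelet_gf k * f\<^bsub>2k\<^esub> * f\<^sub>1^k = f\<^sub>2 f\<^sub>k\<close>, where \<open>f\<^sub>1^k\<close> and \<open>f\<^sub>k\<close> cancel modulo \<open>p\<close>.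
\<close>

lemma bracelet_gf_cong:
  assumes "prime p" "odd p" "k = p ^ i"
  shows "cong_upto N (int p) (bracelet_gf k * euler_prod (2 * k)) (euler_prod 2)"
proof -
  have k: "k > 0" using assms prime_gt_0_nat by auto
  let ?D = "qpoch_inf (- (fps_X ^ k)) (fps_X ^ k)"
  have f1: "euler_prod 1 = qpoch_inf fps_X fps_X" by (simp add: euler_prod_def)
  have "euler_prod 1 ^ k = euler_prod 1 ^ (k - 1) * euler_prod 1"
    by (rule power_minus_mult[OF k, symmetric])
  then have "bracelet_gf k * euler_prod (2 * k) * euler_prod 1 ^ k =
     (bracelet_gf k * (euler_prod 1 ^ (k - 1) * ?D)) * euler_prod 1 * euler_prod k"
    unfolding qpoch_inf_plus_times_minus[OF k, symmetric] by (simp only: mult_ac)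
  also have "\<dots> = qpoch_inf (- (fps_X ^ 1)) (fps_X ^ 1) * euler_prod 1 * euler_prod k"
    unfolding f1 bracelet_gf_mult[OF k] by simp
  also have "\<dots> = euler_prod 2 * euler_prod k"
    by (subst qpoch_inf_plus_times_minus) auto
  finally have exact: "bracelet_gf k * euler_prod (2 * k) * euler_prod 1 ^ k = euler_prod 2 * euler_prod k" .
  have "cong_upto N (int p) (bracelet_gf k * euler_prod (2 * k) * euler_prod k)
     (bracelet_gf k * euler_prod (2 * k) * euler_prod 1 ^ k)"
    unfolding assms(3) using assms
    by (intro cong_upto_mult cong_upto_refl cong_upto_sym[OF euler_prod_frobenius])
  then show ?thesis
    unfolding exact by (rule cong_upto_cancel) (simp add: euler_prod_nth_0 k)
qed

theorem theorem3p4: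
  fixes p \<alpha> k :: nat
  assumes "prime p" and "p \<ge> 5" and "\<alpha> \<ge> 1" and "k = p ^ (2 * \<alpha> - 1)"
  shows
    "fps_cong
       (Abs_fps (\<lambda>n. bracelet k (2 * p ^ (2 * \<alpha> - 1) * n + (p ^ (2 * \<alpha>) - 1) div 12)))
       (fps_const (quad_sign p ^ \<alpha>) * Abs_fps (\<lambda>n. int (num_regular_partitions p n)))
       (int p) \<and>
     fps_cong
       (Abs_fps (\<lambda>n. bracelet k (2 * p ^ (2 * \<alpha> - 1) * n + (p ^ (2 * \<alpha>) - 1) div 12)))
       (fps_const (quad_sign p ^ \<alpha>) *
         (qpoch_inf (fps_X ^ p) (fps_X ^ p) * Abs_fps (\<lambda>n. int (num_partitions n))))
       (int p)"
proof -
  let ?B = "Abs_fps (\<lambda>n. bracelet k (2 * p ^ (2 * \<alpha> - 1) * n + (p ^ (2 * \<alpha>) - 1) div 12))"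
  let ?R = "Abs_fps (\<lambda>n. int (num_regular_partitions p n))"
  let ?P = "Abs_fps (\<lambda>n. int (num_partitions n))"
  let ?s = "fps_const (quad_sign p ^ \<alpha>)"
  have ppos: "p > 0" and odd: "odd p"
    using assms prime_odd_nat by auto
  have kpos: "k > 0" using assms(4) ppos by simp
  \<comment> \<open>This makes \<open>c\<close> below an exact quotient, and the offset \<open>(p^(2 * \<alpha>) - 1) div 12\<close> even.\<close>
  have "[p ^ 2 = 1] (mod 24)"
  proof -
    obtain r where r: "pm_sign p * int p = 6 * r + 1"
      using pm_sign_times_prime assms(1,2) by blast
    have "int p ^ 2 = (pm_sign p * int p) ^ 2"
      by (simp add: power_mult_distrib pm_sign_def)
    also have "\<dots> = 12 * (r * (3 * r + 1)) + 1"
      unfolding r by (simp add: power2_eq_square algebra_simps)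
    finally have "int p ^ 2 - 1 = 12 * (r * (3 * r + 1))"
      by simp
    moreover have "even (r * (3 * r + 1))"
      by simp
    then have "12 * 2 dvd 12 * (r * (3 * r + 1))"
      by (rule mult_dvd_mono[OF dvd_refl])
    ultimately have "24 dvd int p ^ 2 - 1"
      by simp
    then have "[int (p ^ 2) = int 1] (mod int 24)"
      by (simp add: cong_iff_dvd_diff)
    then show ?thesis
      by (simp only: cong_int_iff)
  qed
  then have "[(p ^ 2) ^ \<alpha> = 1 ^ \<alpha>] (mod 24)" by (rule cong_pow)
  then have mod: "p ^ (2 * \<alpha>) mod 24 = 1" by (simp add: cong_def power_mult)
  define c where "c = p ^ (2 * \<alpha>) div 24"
  have c: "24 * c + 1 = p ^ (2 * \<alpha>)"
    using mod unfolding c_def by presburger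
  then have c12: "(p ^ (2 * \<alpha>) - 1) div 12 = 2 * c" by (simp flip: c)
  have inverse: "(?P oo fps_X ^ (2 * k)) * euler_prod (2 * k) = 1"
    using kpos
    by (simp add: euler_prod_dilate[of "2 * k"] num_partitions_gf_times_euler_prod[unfolded One_nat_def]
          flip: fps_compose_mult_distrib)
  \<comment> \<open>The series \<open>f\<^sub>2 / f\<^bsub>2k\<^esub>\<close>, to which the bracelet series reduces.\<close>
  let ?F = "euler_prod 2 * (?P oo fps_X ^ (2 * k))"
  have even_nth: "fps_nth (euler_prod 2) n = (if even n then fps_nth (euler_prod 1) (n div 2) else 0)" for n
    by (simp add: euler_prod_dilate[of 2] fps_compose_X_power_nth)
  have "fps_section (2 * k) (2 * c) ?F = fps_section (2 * k) (2 * c) (euler_prod 2) * ?P"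
  proof (rule fps_section_mult_dilate)
    fix i assume i: "i < 2 * c" "2 * k dvd 2 * c - i"
    show "fps_nth (euler_prod 2) i = 0"
    proof (cases "even i")
      case True
      then obtain j where j: "i = 2 * j" by blast
      then have "j < c" "k dvd c - j" using i by (auto simp flip: diff_mult_distrib2)
      then have "fps_nth (euler_prod 1) j = 0"
        using euler_prod_nth_eq_0 assms c by blast
      then show ?thesis by (simp add: even_nth j)
    qed (simp add: even_nth)
  qed (use kpos in simp)
  also have "fps_section (2 * k) (2 * c) (euler_prod 2) = fps_section k c (euler_prod 1)"
    by (simp add: fps_section_def even_nth)
  also have "\<dots> = ?s * euler_prod p"
    using assms c by (rule euler_prod_section)
  finally have section_F: "fps_section (2 * k) (2 * c) ?F = ?s * (euler_prod p * ?P)"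
    by (simp only: mult.assoc)
  have "cong_upto N (int p) (bracelet_gf k) ?F" for N
  proof (rule cong_upto_cancel)
    show "cong_upto N (int p) (bracelet_gf k * euler_prod (2 * k)) (?F * euler_prod (2 * k))"
      unfolding mult.assoc inverse mult_1_right
      using assms(1) odd assms(4) by (rule bracelet_gf_cong)
    show "fps_nth (euler_prod (2 * k)) 0 = 1"
      using kpos by (simp add: euler_prod_nth_0)
  qed
  then have "fps_cong (fps_section (2 * k) (2 * c) (bracelet_gf k)) (?s * (euler_prod p * ?P)) (int p)"
    unfolding section_F[symmetric] by (auto simp: fps_cong_def cong_upto_def fps_section_def)
  moreover have "fps_section (2 * k) (2 * c) (bracelet_gf k) = ?B"
    unfolding fps_section_def bracelet_def c12 assms(4) by simp
  ultimately have main: "fps_cong ?B (?s * (euler_prod p * ?P)) (int p)"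
    by simp
  have "euler_prod p * ?P = ?R * (?P * euler_prod 1)"
    by (simp add: num_regular_partitions_gf_times_euler_prod[OF ppos, symmetric] mult_ac)
  then have "euler_prod p * ?P = ?R"
    unfolding num_partitions_gf_times_euler_prod by simp
  with main show ?thesis by (simp add: euler_prod_def)
qed

end
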